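(* Let $q$ be a prime power, $n,r$ positive integers, and $U_1,\ldots,U_r$ $\mathbb{F}_q$-subspaces of $\mathbb{F}_{q^n}$ with $k_i=\dim_{\mathbb{F}_q}(U_i)\geq 2$ for all $i$ and $\sum_{i=1}^rk_i=k\leq(r-1)n$. Let $U=U_1\times\cdots\times U_r\subseteq\mathbb{F}_{q^n}^r$ and $P_i=\langle\mathbf{e}_i\rangle_{\mathbb{F}_{q^n}}$, where $\mathbf{e}_i$ is the $i$-th standard basis vector. The following are equivalent: (i) every point of $L_U$ different from $P_1,\ldots,P_r$ has weight one in $L_U$; (ii) $U_i\cdot U_i^{-1}\cap U_j\cdot U_j^{-1}=\mathbb{F}_q$ for all $i\neq j$; (iii) $\dim_{\mathbb{F}_q}(U_i\cap\alpha U_j)\leq 1$ for every $\alpha\in\mathbb{F}_{q^n}^*$ and all $i\neq j$.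
   Context: $U^{-1}=\{u^{-1}:u\in U\setminus\{0\}\}$, $U\cdot V=\{uv:u\in U,v\in V\}$. For an $\mathbb{F}_q$-subspace $W$ of $\mathbb{F}_{q^n}^r$, $L_W=\{\langle\mathbf{w}\rangle_{\mathbb{F}_{q^n}}:\mathbf{w}\in W\setminus\{\mathbf{0}\}\}\subseteq\mathrm{PG}(r-1,q^n)$ and $w_{L_W}(\langle\mathbf{v}\rangle_{\mathbb{F}_{q^n}})=\dim_{\mathbb{F}_q}(W\cap\langle\mathbf{v}\rangle_{\mathbb{F}_{q^n}})$. *)

theory Defs
  imports
    "HOL-Analysis.Cartesian_Space"
    "HOL-Library.Set_Algebras"
    "HOL-Number_Theory.Prime_Powers"
begin

text \<open>
  The extension of the field with \<open>q^n\<close> elements over the field with \<open>q\<close> elements is given by two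
  finite field types \<open>'a\<close> and \<open>'k\<close> and a field homomorphism \<open>\<iota> :: 'k \<Rightarrow> 'a\<close> (necessarily
  injective). The subfield with \<open>q\<close> elements of \<open>'a\<close> is \<open>range \<iota>\<close>.
\<close>

definition field_embedding :: "('k::field \<Rightarrow> 'a::field) \<Rightarrow> bool" where
  "field_embedding \<iota> \<longleftrightarrow>
     \<iota> 1 = 1 \<and> (\<forall>x y. \<iota> (x + y) = \<iota> x + \<iota> y) \<and> (\<forall>x y. \<iota> (x * y) = \<iota> x * \<iota> y)"

definition scale_field :: "('k::field \<Rightarrow> 'a::field) \<Rightarrow> 'k \<Rightarrow> 'a \<Rightarrow> 'a" where
  "scale_field \<iota> c x = \<iota> c * x"

definition scale_vec :: "('k::field \<Rightarrow> 'a::field) \<Rightarrow> 'k \<Rightarrow> 'a ^ 'r \<Rightarrow> 'a ^ 'r" where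
  "scale_vec \<iota> c v = \<iota> c *s v"

lemma vector_space_scale_field: "field_embedding \<iota> \<Longrightarrow> vector_space (scale_field \<iota>)"
  by unfold_locales (simp_all add: field_embedding_def scale_field_def algebra_simps)

lemma vector_space_scale_vec: "field_embedding \<iota> \<Longrightarrow> vector_space (scale_vec \<iota>)"
  by unfold_locales (simp_all add: field_embedding_def scale_vec_def vec_eq_iff algebra_simps)

definition inv_set :: "'a::field set \<Rightarrow> 'a set" where
  "inv_set U = inverse ` (U - {0})"

definition prod_space :: "('r \<Rightarrow> 'a set) \<Rightarrow> ('a ^ 'r) set" where
  "prod_space U = {v. \<forall>i. v $ i \<in> U i}"

text \<open>
  A point of the projective space is identified with the corresponding one-dimensional
  \<open>'a\<close>-subspace of \<open>'a ^ 'r\<close>; note that \<open>vec.span\<close> is the span over \<open>'a\<close>.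
\<close>

definition point :: "'a::field ^ 'r \<Rightarrow> ('a ^ 'r) set" where
  "point v = vec.span {v}"

definition linear_set :: "('a::field ^ 'r) set \<Rightarrow> ('a ^ 'r) set set" where
  "linear_set W = point ` (W - {0})"

definition weight ::
  "('k::field \<Rightarrow> 'a::field) \<Rightarrow> ('a ^ 'r) set \<Rightarrow> ('a ^ 'r) set \<Rightarrow> nat" where
  "weight \<iota> W P = vector_space.dim (scale_vec \<iota>) (W \<inter> P)"

end

theory Submission
  imports Defs
begin

text \<open>
  All three conditions say that, for \<open>i \<noteq> j\<close>, every ratio \<open>a / b = c / d\<close> with \<open>a, b \<in> U i\<close> and
  \<open>c, d \<in> U j\<close> lies in the small field. For (iii), such a coincidence places \<open>a\<close> and \<open>b\<close> in
  \<open>U i \<inter> \<alpha> U j\<close> with \<open>\<alpha> = b / d\<close>. For (i), it places both \<open>b e\<^sub>i + d e\<^sub>j\<close> and its multiple by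
  \<open>a / b\<close> in the product space; conversely a point other than the \<open>P\<^sub>i\<close> has two nonzero coordinates.
\<close>

text \<open>\<open>S\<close> need not be a subspace. Extending \<open>{v}\<close> to a maximal
  independent subset \<open>B\<close> of \<open>S\<close> gives \<open>dim S = card B\<close>, so
  both claims are read off from \<open>B\<close>. Finiteness rules out \<open>card B = 0\<close> as
  the default value for an infinite \<open>B\<close>.\<close>

lemma (in vector_space) dim_eq_1_iff_subset_span:
  assumes "finite S" "v \<in> S" "v \<noteq> 0"
  shows "dim S = 1 \<longleftrightarrow> S \<subseteq> span {v}" and "dim S \<ge> 1"
proof -
  have ind: "independent {v}"
    using assms(3) by simp
  obtain B where B: "{v} \<subseteq> B" "B \<subseteq> S" "independent B" "S \<subseteq> span B"
    using maximal_independent_subset_extend[of "{v}" S] assms(2) ind by blast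
  have card: "dim S = card B"
    using B by (intro dim_unique) auto
  have fin: "finite B"
    using B(2) assms(1) finite_subset by blast
  show "dim S \<ge> 1"
    using card fin B(1) by (simp add: Suc_le_eq card_gt_0_iff) blast
  show "dim S = 1 \<longleftrightarrow> S \<subseteq> span {v}"
  proof
    assume "dim S = 1"
    then have "B = {v}"
      using card B(1) by (auto simp: card_1_singleton_iff)
    then show "S \<subseteq> span {v}"
      using B(4) by simp
  next
    assume "S \<subseteq> span {v}"
    then show "dim S = 1"
      using dim_unique[of "{v}" S 1] assms(2) ind by simp
  qed
qed

text \<open>Turns the dimension bound of (iii) into a statement about scalar multiples. If
  \<open>S\<close> has no nonzero vector, the right side is vacuous and the dimension is 0;
  otherwise the dimension is at least 1 and the previous lemma applies.\<close>

lemma (in vector_space) dim_le_1_iff_subset_span: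
  assumes "finite S"
  shows "dim S \<le> 1 \<longleftrightarrow> (\<forall>v\<in>S. v \<noteq> 0 \<longrightarrow> S \<subseteq> span {v})"
proof (cases "S \<subseteq> {0}")
  case True
  then have "dim S = 0"
    using dim_unique[of "{}" S 0] span_empty by (auto simp: independent_empty subset_singleton_iff)
  then show ?thesis
    using True by auto
next
  case False
  then show ?thesis
    using dim_eq_1_iff_subset_span[OF assms] by (metis insertI1 le_antisym order_refl subset_iff)
qed

lemma point_eq: "point v = range (\<lambda>c. c *s v)"
  by (simp add: point_def vec.span_singleton)

lemma point_scale:
  assumes "c \<noteq> 0"
  shows "point (c *s v) = point v"
proof -
  have "range (\<lambda>x. x *s (c *s v)) = (\<lambda>x. x *s v) ` range (\<lambda>x. x * c)"
    by (simp add: image_image vector_smult_assoc)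
  also have "range (\<lambda>x. x * c) = UNIV"
    using assms by (intro surjI[of _ "\<lambda>x. x / c"]) simp
  finally show ?thesis
    by (simp only: point_eq)
qed

text \<open>Common language for all three conditions: \<open>x\<close> is a ratio of elements of
  \<open>A\<close> when multiplication by \<open>x\<close> keeps some nonzero \<open>b\<close> in
  \<open>A\<close>.\<close>

lemma mem_mult_inv_set_iff:
  "x \<in> A * inv_set A \<longleftrightarrow> (\<exists>b\<in>A. b \<noteq> 0 \<and> x * b \<in> A)"
proof
  assume "x \<in> A * inv_set A"
  then obtain a b where ab: "a \<in> A" "b \<in> A" "b \<noteq> 0" "x = a * inverse b"
    by (auto simp: inv_set_def elim!: set_times_elim)
  then have "x * b \<in> A"
    by (simp add: mult.assoc)
  with ab(2,3) show "\<exists>b\<in>A. b \<noteq> 0 \<and> x * b \<in> A"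
    by (intro bexI[of _ b] conjI)
next
  assume "\<exists>b\<in>A. b \<noteq> 0 \<and> x * b \<in> A"
  then obtain b where b: "b \<in> A" "b \<noteq> 0" "x * b \<in> A"
    by blast
  then have "(x * b) * inverse b \<in> A * inv_set A"
    unfolding inv_set_def by (intro set_times_intro) auto
  then show "x \<in> A * inv_set A"
    using b(2) by (simp add: mult.assoc)
qed

text \<open>A scalar is the ratio of a scalar multiple of \<open>b\<close> to \<open>b\<close>. This
  is the half of the equality in (ii) that always holds.\<close>

lemma range_subset_mult_inv_set:
  assumes "field_embedding \<iota>" "module.subspace (scale_field \<iota>) A" "b \<in> A" "b \<noteq> 0"
  shows "range \<iota> \<subseteq> A * inv_set A"
proof -
  interpret vector_space "scale_field \<iota>"
    by (rule vector_space_scale_field) fact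
  have "\<iota> c * b \<in> A" for c
    using subspace_scale[OF assms(2,3), of c] by (simp add: scale_field_def)
  then show ?thesis
    using assms(3,4) unfolding image_subset_iff mem_mult_inv_set_iff by blast
qed

lemma dim_Int_scaled_le_1_iff:
  fixes \<iota> :: "'k::field \<Rightarrow> 'a::{field,finite}"
  assumes "field_embedding \<iota>"
  shows "(\<forall>\<alpha>. \<alpha> \<noteq> 0 \<longrightarrow> vector_space.dim (scale_field \<iota>) (A \<inter> (\<alpha> *o B)) \<le> 1) \<longleftrightarrow>
    (A * inv_set A) \<inter> (B * inv_set B) \<subseteq> range \<iota>"
proof -
  interpret vector_space "scale_field \<iota>"
    by (rule vector_space_scale_field) fact
  show ?thesis
  proof (intro iffI allI impI subsetI)
    fix z
    assume dim: "\<forall>\<alpha>. \<alpha> \<noteq> 0 \<longrightarrow> dim (A \<inter> (\<alpha> *o B)) \<le> 1"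
      and "z \<in> (A * inv_set A) \<inter> (B * inv_set B)"
    then obtain b d where b: "b \<in> A" "b \<noteq> 0" "z * b \<in> A" and d: "d \<in> B" "d \<noteq> 0" "z * d \<in> B"
      by (auto simp: mem_mult_inv_set_iff)
    \<comment> \<open>The factor \<open>b / d\<close> sends \<open>d\<close> to \<open>b\<close>,
      hence also \<open>z * d\<close> to \<open>z * b\<close>, so the intersection contains two
      vectors of ratio \<open>z\<close>.\<close>
    let ?S = "A \<inter> ((b / d) *o B)"
    have "b = b / d * d" "z * b = b / d * (z * d)"
      using d by simp_all
    then have mem: "b \<in> ?S" "z * b \<in> ?S"
      using b d unfolding elt_set_times_def by blast+
    have "dim ?S \<le> 1"
      using dim b d by simp
    then have "z * b \<in> span {b}"
      using mem b(2) unfolding dim_le_1_iff_subset_span[OF finite] by blast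
    then show "z \<in> range \<iota>"
      using b(2) by (auto simp: span_singleton scale_field_def)
  next
    fix \<alpha> :: 'a
    assume sub: "(A * inv_set A) \<inter> (B * inv_set B) \<subseteq> range \<iota>" and \<alpha>: "\<alpha> \<noteq> 0"
    have "x \<in> span {v}" if "v \<in> A \<inter> (\<alpha> *o B)" "v \<noteq> 0" "x \<in> A \<inter> (\<alpha> *o B)" for v x
    proof -
      obtain c d where c: "c \<in> B" "x = \<alpha> * c" and d: "d \<in> B" "v = \<alpha> * d"
        using \<open>v \<in> A \<inter> (\<alpha> *o B)\<close> \<open>x \<in> A \<inter> (\<alpha> *o B)\<close> by (auto simp: elt_set_times_def)
      \<comment> \<open>The factor \<alpha> cancels: \<open>x / v\<close> equals
        \<open>c / d\<close>, so it is a ratio in \<open>A\<close>, with denominator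
        \<open>v\<close>, and in \<open>B\<close>, with denominator \<open>d\<close>.\<close>
      have "x / v * v = x" "x / v * d = c"
        using \<alpha> \<open>v \<noteq> 0\<close> c d by simp_all
      moreover have "d \<noteq> 0"
        using d \<open>v \<noteq> 0\<close> by auto
      ultimately have "x / v \<in> A * inv_set A" "x / v \<in> B * inv_set B"
        using that c(1) d(1) unfolding mem_mult_inv_set_iff by (metis IntD1)+
      then have "x / v \<in> range \<iota>"
        using sub by blast
      then obtain e where "x / v = \<iota> e"
        by blast
      then have "x = scale_field \<iota> e v"
        using \<open>v \<noteq> 0\<close> by (simp add: scale_field_def field_simps)
      then show ?thesis
        by (auto simp: span_singleton)
    qed
    then show "dim (A \<inter> (\<alpha> *o B)) \<le> 1"
      unfolding dim_le_1_iff_subset_span[OF finite] by blast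
  qed
qed

text \<open>The vectors of \<open>W\<close> on the point are the multiples \<open>c *s v\<close>
  lying in \<open>W\<close>, and since \<open>v\<close> is nonzero each such vector determines its
  coefficient \<open>c\<close>.\<close>

lemma weight_point_eq_1_iff:
  fixes \<iota> :: "'k::field \<Rightarrow> 'a::{field,finite}" and v :: "'a ^ 'r::finite"
  assumes "field_embedding \<iota>" "v \<in> W" "v \<noteq> 0"
  shows "weight \<iota> W (point v) = 1 \<longleftrightarrow> (\<forall>c. c *s v \<in> W \<longrightarrow> c \<in> range \<iota>)"
proof -
  interpret vector_space "scale_vec \<iota> :: 'k \<Rightarrow> 'a ^ 'r \<Rightarrow> 'a ^ 'r"
    by (rule vector_space_scale_vec) fact
  have "v \<in> point v"
    by (simp add: point_def vec.span_base)
  then have "weight \<iota> W (point v) = 1 \<longleftrightarrow> W \<inter> point v \<subseteq> span {v}"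
    unfolding weight_def using assms by (intro dim_eq_1_iff_subset_span) auto
  also have "\<dots> \<longleftrightarrow> (\<forall>c. c *s v \<in> W \<longrightarrow> c *s v \<in> span {v})"
    by (auto simp: point_eq)
  also have "\<dots> \<longleftrightarrow> (\<forall>c. c *s v \<in> W \<longrightarrow> c \<in> range \<iota>)"
    using assms(3) by (simp add: span_singleton scale_vec_def image_iff)
  finally show ?thesis .
qed

text \<open>Coordinate form of the exclusion in (i): a nonzero vector off the coordinate points has
  at least two nonzero entries.\<close>

lemma point_eq_axis_iff:
  fixes v :: "'a::field ^ 'r::finite"
  assumes "v \<noteq> 0"
  shows "(\<exists>i. point v = point (axis i 1)) \<longleftrightarrow> (\<exists>i. \<forall>j. j \<noteq> i \<longrightarrow> v $ j = 0)"
proof (intro iffI; elim exE)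
  fix i
  assume "point v = point (axis i 1)"
  moreover have "v \<in> point v"
    by (simp add: point_def vec.span_base)
  ultimately obtain c where "v = c *s axis i 1"
    by (auto simp: point_eq)
  then have "\<forall>j. j \<noteq> i \<longrightarrow> v $ j = 0"
    by (simp add: axis_def)
  then show "\<exists>i. \<forall>j. j \<noteq> i \<longrightarrow> v $ j = 0" ..
next
  fix i
  assume "\<forall>j. j \<noteq> i \<longrightarrow> v $ j = 0"
  then have v: "v = v $ i *s axis i 1"
    by (auto simp: vec_eq_iff axis_def)
  then have "v $ i \<noteq> 0"
    using assms by (metis vector_smult_lzero)
  then have "point v = point (axis i 1)"
    using v point_scale by metis
  then show "\<exists>i. point v = point (axis i 1)" ..
qed

lemma weights_eq_1_iff:
  fixes \<iota> :: "'k::field \<Rightarrow> 'a::{field,finite}" and U :: "'r::finite \<Rightarrow> 'a set"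
  assumes "field_embedding \<iota>" and zero: "\<And>i. 0 \<in> U i"
  shows "(\<forall>P \<in> linear_set (prod_space U).
      (\<forall>i. P \<noteq> point (axis i 1)) \<longrightarrow> weight \<iota> (prod_space U) P = 1) \<longleftrightarrow>
    (\<forall>i j. i \<noteq> j \<longrightarrow> (U i * inv_set (U i)) \<inter> (U j * inv_set (U j)) \<subseteq> range \<iota>)"
    (is "?L \<longleftrightarrow> ?R")
proof -
  \<comment> \<open>Points are replaced by representatives in the product space, which removes
    weights and spans from the condition.\<close>
  have "?L \<longleftrightarrow> (\<forall>v\<in>prod_space U - {0}. (\<nexists>i. \<forall>j. j \<noteq> i \<longrightarrow> v $ j = 0) \<longrightarrow>
      (\<forall>c. c *s v \<in> prod_space U \<longrightarrow> c \<in> range \<iota>))" (is "_ \<longleftrightarrow> ?M")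
    unfolding linear_set_def ball_simps
  proof (rule ball_cong[OF refl], goal_cases)
    case (1 v)
    then show ?case
      using weight_point_eq_1_iff[OF assms(1), of v "prod_space U"] point_eq_axis_iff[of v]
      by blast
  qed
  also have "?M \<longleftrightarrow> ?R"
  proof
    assume M: ?M
    show ?R
    proof (intro allI impI subsetI)
      fix i j z
      assume ij: "i \<noteq> j" and "z \<in> (U i * inv_set (U i)) \<inter> (U j * inv_set (U j))"
      then obtain b d where b: "b \<in> U i" "b \<noteq> 0" "z * b \<in> U i"
        and d: "d \<in> U j" "d \<noteq> 0" "z * d \<in> U j"
        by (auto simp: mem_mult_inv_set_iff)
      \<comment> \<open>Two nonzero entries keep the point of \<open>v\<close> off the axes, while
        \<open>z *s v\<close> stays in the product space; the other entries are allowed because each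
        \<open>U m\<close> contains 0.\<close>
      define v :: "'a ^ 'r" where "v = (\<chi> m. if m = i then b else if m = j then d else 0)"
      have comps: "v $ i = b" "v $ j = d"
        using ij by (simp_all add: v_def)
      have "v \<in> prod_space U" "z *s v \<in> prod_space U"
        using b d zero by (auto simp: prod_space_def v_def)
      moreover have "v \<noteq> 0"
        using comps b(2) by auto
      moreover have "\<nexists>m. \<forall>l. l \<noteq> m \<longrightarrow> v $ l = 0"
        using comps b(2) d(2) ij by metis
      ultimately show "z \<in> range \<iota>"
        using M by blast
    qed
  next
    assume R: ?R
    show ?M
    proof (intro ballI impI allI)
      fix v c
      assume v: "v \<in> prod_space U - {0}" "\<nexists>i. \<forall>j. j \<noteq> i \<longrightarrow> v $ j = 0"
        and c: "c *s v \<in> prod_space U"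
      obtain i where i: "v $ i \<noteq> 0"
        using v(1) by (auto simp: vec_eq_iff)
      obtain j where j: "j \<noteq> i" "v $ j \<noteq> 0"
        using v(2) by blast
      \<comment> \<open>Any nonzero entry serves as denominator, with the same entry of
        \<open>c *s v\<close> as numerator; taking \<open>m\<close> to be \<open>i\<close> and
        \<open>j\<close> puts \<open>c\<close> in two ratio sets.\<close>
      have "c \<in> U m * inv_set (U m)" if "v $ m \<noteq> 0" for m
        using v(1) c that by (auto simp: mem_mult_inv_set_iff prod_space_def)
      then show "c \<in> range \<iota>"
        using R i j by blast
    qed
  qed
  finally show ?thesis .
qed

theorem theorem7p2:
  fixes \<iota> :: "'k::{field,finite} \<Rightarrow> 'a::{field,finite}"
    and U :: "'r::finite \<Rightarrow> 'a set"
    and q n r k :: nat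
  assumes "primepow q" and "n \<ge> 1" and "r \<ge> 1"
    and "CARD('k) = q" and "CARD('a) = q ^ n" and "CARD('r) = r"
    and "field_embedding \<iota>"
    and "\<And>i. module.subspace (scale_field \<iota>) (U i)"
    and "\<And>i. vector_space.dim (scale_field \<iota>) (U i) \<ge> 2"
    and "(\<Sum>i\<in>UNIV. vector_space.dim (scale_field \<iota>) (U i)) = k"
    and "k \<le> (r - 1) * n"
  defines "cond_i \<equiv>
      \<forall>P \<in> linear_set (prod_space U).
        (\<forall>i. P \<noteq> point (axis i 1)) \<longrightarrow> weight \<iota> (prod_space U) P = 1"
    and "cond_ii \<equiv>
      \<forall>i j. i \<noteq> j \<longrightarrow> (U i * inv_set (U i)) \<inter> (U j * inv_set (U j)) = range \<iota>"
    and "cond_iii \<equiv>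
      \<forall>i j. i \<noteq> j \<longrightarrow>
        (\<forall>\<alpha>. \<alpha> \<noteq> 0 \<longrightarrow> vector_space.dim (scale_field \<iota>) (U i \<inter> (\<alpha> *o U j)) \<le> 1)"
  shows "(cond_i \<longleftrightarrow> cond_ii) \<and> (cond_ii \<longleftrightarrow> cond_iii)"
proof -
  interpret vector_space "scale_field \<iota>"
    by (rule vector_space_scale_field) fact
  have sub: "subspace (U i)" for i
    by fact
  \<comment> \<open>The lower bound on the dimension provides a nonzero element of
    \<open>U i\<close>. With this inclusion, the equality in (ii) amounts to one inclusion, the form
    that both (i) and (iii) reduce to.\<close>
  have "range \<iota> \<subseteq> U i * inv_set (U i)" for i
  proof -
    have "\<not> dim (U i) \<le> 1"
      using assms(9)[of i] by simp
    then obtain b where "b \<in> U i" "b \<noteq> 0"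
      unfolding dim_le_1_iff_subset_span[OF finite] by blast
    then show ?thesis
      using range_subset_mult_inv_set[OF assms(7) sub] by simp
  qed
  then have ii: "cond_ii \<longleftrightarrow>
      (\<forall>i j. i \<noteq> j \<longrightarrow> (U i * inv_set (U i)) \<inter> (U j * inv_set (U j)) \<subseteq> range \<iota>)"
    unfolding cond_ii_def by blast
  show ?thesis
    unfolding ii unfolding cond_i_def cond_iii_def
      weights_eq_1_iff[OF assms(7) subspace_0[OF sub]] dim_Int_scaled_le_1_iff[OF assms(7)]
    by blast
qed

end
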